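(* Let $n\ge 2$ and let $A\in\mathrm{GL}_n(\mathbb{R})$, $\|A\|_{\max}=1$, be a Higham$^2$ matrix of the form $$A=\begin{pmatrix}\hat L & 0\\ -\mathbf{1}^T & 1\end{pmatrix}\begin{pmatrix}\hat U & \mathbf{u}\\ 0 & 2^{n-1}\end{pmatrix}=\begin{pmatrix}\hat L\hat U & \mathbf{1}\\ -\mathbf{1}^T\hat U & 1\end{pmatrix},$$ where $\hat L\in\mathrm{GL}_{n-1}(\mathbb{R})$ is lower unitriangular with $\hat L_{ij}=-1$ for all $i>j$, $\mathbf{1}=(1,\dots,1)^T\in\mathbb{R}^{n-1}$, $\mathbf{u}=(1,2,\dots,2^{n-2})^T\in\mathbb{R}^{n-1}$, and $\hat U\in\mathrm{GL}_{n-1}(\mathbb{R})$ is upper triangular with $\|\hat L\hat U\|_{\max}\le 1$ and $\|\mathbf{1}^T\hat U\|_\infty\le 1$. Let $\epsilon\in\mathbb{R}$ and $1\le i,j\le n$. If the LU factorization (without pivoting) of $A+\epsilon\,\mathbf{e}_i\mathbf{e}_j^T$ exists, then its last pivot $p^{(i,j)}_\epsilon$ is given as follows. If $i<j<n$, then $$p^{(i,j)}_\epsilon=\frac{1}{2^{1-n}+\epsilon\,2^{-i}\sum_{\ell=1}^{n-j}2^{-\ell}\,\hat U^{-1}_{j,n-\ell}}.$$ If $j\le i<n$, then $$p^{(i,j)}_\epsilon=\frac{1+\tfrac12\epsilon\left(\hat U^{-1}_{ji}-\sum_{\ell=1}^{i-j}2^{-\ell}\,\hat U^{-1}_{j,i-\ell}\right)}{2^{1-n}+\epsilon\left(2^{1-n}\,\hat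 U^{-1}_{ji}+2^{-i}\sum_{\ell=1}^{n-i-1}2^{-\ell}\,\hat U^{-1}_{j,n-\ell}\right)}.$$ If $i<n$, then $p^{(i,n)}_\epsilon=2^{n-1}(1+\epsilon\,2^{-i})$. If $j<n$, then $p^{(n,j)}_\epsilon=2^{n-1}\left(1-\epsilon\sum_{\ell=1}^{n-j}2^{-\ell}\,\hat U^{-1}_{j,n-\ell}\right)$. Finally, $p^{(n,n)}_\epsilon=2^{n-1}+\epsilon$.
   Context: Notation: $\mathbf{e}_i$ is the $i$th standard basis vector of $\mathbb{R}^n$; $\|M\|_{\max}=\max_{i,j}|M_{ij}|$; $\hat U^{-1}_{jk}$ denotes the $(j,k)$ entry of the inverse matrix $\hat U^{-1}$; empty sums are zero; "lower unitriangular" means lower triangular with ones on the diagonal. The LU factorization (without pivoting) of $M\in\mathbb{R}^{n\times n}$ is $M=LU$ with $L$ lower unitriangular and $U$ upper triangular, as computed by Gaussian elimination without row interchanges. It is said to exist when this elimination can be carried out, i.e. when the pivots it divides by are nonzero (equivalently, the leading principal minors of $M$ of orders $1,\dots,n-1$ are nonzero), in which case it is unique. The last pivot is $U_{nn}$. Higham$^2$ matrices are the real $n\times n$ matrices attaining the maximal growth factor $2^{n-1}$ in Gaussian elimination with partial pivoting. When normalized by $\|A\|_{\max}=1$, they have the form displayed in the claim after left multiplication by a suitable permutation matrix $P$ and a $\pm1$ diagonal matrix $D$. The claim concerns those with $P=D=I$, i.e. the matrices of exactly the displayed form. *)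

theory Defs
  imports "Jordan_Normal_Form.Gauss_Jordan_Elimination"
begin

text \<open>Matrices are those of \<^theory>\<open>Jordan_Normal_Form.Matrix\<close>, so that the order \<open>n\<close> is a natural
  number and rows and columns are numbered from 0. The statement itself is written with the
  customary numbering from 1, through the following abbreviation.\<close>

abbreviation entry1 :: "'a mat \<Rightarrow> nat \<Rightarrow> nat \<Rightarrow> 'a" where
  "entry1 M i j \<equiv> M $$ (i - 1, j - 1)"

text \<open>\<open>\<parallel>M\<parallel>\<^sub>m\<^sub>a\<^sub>x\<close> for matrices and \<open>\<parallel>v\<parallel>\<^sub>\<infinity>\<close> for vectors. Both are meant for nonempty arguments only
  (the maximum of the empty set is unspecified).\<close>

definition max_norm :: "real mat \<Rightarrow> real" where
  "max_norm M = Max {\<bar>M $$ (i, j)\<bar> | i j. i < dim_row M \<and> j < dim_col M}"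

definition inf_norm_vec :: "real vec \<Rightarrow> real" where
  "inf_norm_vec v = Max {\<bar>v $ i\<bar> | i. i < dim_vec v}"

definition ones_vec :: "nat \<Rightarrow> real vec" where
  "ones_vec m = vec m (\<lambda>_. 1)"

text \<open>The vector \<open>(1, 2, \<dots>, 2\<^sup>m\<^sup>-\<^sup>1)\<close>.\<close>

definition pow2_vec :: "nat \<Rightarrow> real vec" where
  "pow2_vec m = vec m (\<lambda>i. 2 ^ i)"

definition mat_of_col :: "'a vec \<Rightarrow> 'a mat" where
  "mat_of_col v = mat_of_cols (dim_vec v) [v]"

definition lower_unitriangular :: "'a::{zero,one} mat \<Rightarrow> bool" where
  "lower_unitriangular L \<longleftrightarrow>
     (\<forall>i < dim_row L. \<forall>j < dim_col L. (i < j \<longrightarrow> L $$ (i, j) = 0) \<and> (i = j \<longrightarrow> L $$ (i, j) = 1))"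

subsection \<open>Gaussian elimination without row interchanges\<close>

text \<open>Step \<open>k\<close> (counted from 0) subtracts from each row \<open>i > k\<close> the multiple of row \<open>k\<close> that
  annihilates the entry in position \<open>(i, k)\<close>.\<close>

definition elim_step :: "nat \<Rightarrow> 'a::field mat \<Rightarrow> 'a mat" where
  "elim_step k M = mat (dim_row M) (dim_col M)
     (\<lambda>(i, j). if k < i then M $$ (i, j) - M $$ (i, k) / M $$ (k, k) * M $$ (k, j) else M $$ (i, j))"

fun elim :: "'a::field mat \<Rightarrow> nat \<Rightarrow> 'a mat" where
  "elim M 0 = M"
| "elim M (Suc k) = elim_step k (elim M k)"

text \<open>An \<open>n \<times> n\<close> matrix needs the \<open>n - 1\<close> steps \<open>0, \<dots>, n - 2\<close>, and these are the only ones that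
  divide; the last pivot may vanish.\<close>

definition lu_exists :: "'a::field mat \<Rightarrow> bool" where
  "lu_exists M \<longleftrightarrow> (\<forall>k < dim_row M - 1. elim M k $$ (k, k) \<noteq> 0)"

definition lu_lower :: "'a::field mat \<Rightarrow> 'a mat" where
  "lu_lower M = mat (dim_row M) (dim_row M)
     (\<lambda>(i, j). if i = j then 1 else if j < i then elim M j $$ (i, j) / elim M j $$ (j, j) else 0)"

definition lu_upper :: "'a::field mat \<Rightarrow> 'a mat" where
  "lu_upper M = elim M (dim_row M - 1)"

definition lu_last_pivot :: "'a::field mat \<Rightarrow> 'a" where
  "lu_last_pivot M = lu_upper M $$ (dim_row M - 1, dim_row M - 1)"

lemma dim_elim [simp]: "dim_row (elim M k) = dim_row M" "dim_col (elim M k) = dim_col M"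
  by (induction k) (auto simp: elim_step_def)

lemma elim_Suc_index:
  assumes "i < dim_row M" "j < dim_col M"
  shows "elim M (Suc k) $$ (i, j) =
    (if k < i then elim M k $$ (i, j) - elim M k $$ (i, k) / elim M k $$ (k, k) * elim M k $$ (k, j)
     else elim M k $$ (i, j))"
  using assms by (simp add: elim_step_def)

lemma elim_row_final:
  assumes "i < dim_row M" "j < dim_col M" "i \<le> k"
  shows "elim M k $$ (i, j) = elim M i $$ (i, j)"
  using assms(3)
proof (induction k rule: dec_induct)
  case (step k)
  then show ?case using elim_Suc_index[OF assms(1,2), of k] by simp
qed simp

lemma elim_col_zero:
  assumes "M \<in> carrier_mat n n" and nz: "lu_exists M"
    and "k \<le> n - 1" "j < k" "j < i" "i < n"
  shows "elim M k $$ (i, j) = 0"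
  using assms(3,4,5,6)
proof (induction k arbitrary: i)
  case (Suc k)
  from assms(1) have d: "dim_row M = n" "dim_col M = n" by auto
  from nz d Suc.prems have kk: "elim M k $$ (k, k) \<noteq> 0" by (auto simp: lu_exists_def)
  show ?case
  proof (cases "j = k")
    case True
    with kk d Suc.prems show ?thesis by (subst elim_Suc_index) auto
  next
    case False
    with Suc.prems have jk: "j < k" by simp
    with Suc have "elim M k $$ (i, j) = 0" "elim M k $$ (k, j) = 0" by auto
    with d Suc.prems show ?thesis by (subst elim_Suc_index) auto
  qed
qed simp

lemma elim_telescope:
  assumes "i < dim_row M" "j < dim_col M"
  shows "M $$ (i, j) = elim M k $$ (i, j) +
    (\<Sum>l < min i k. elim M l $$ (i, l) / elim M l $$ (l, l) * elim M l $$ (l, j))"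
proof (induction k)
  case (Suc k)
  show ?case
  proof (cases "k < i")
    case True
    then have "min i (Suc k) = Suc k" "min i k = k" by auto
    with Suc True elim_Suc_index[OF assms, of k] show ?thesis by simp
  next
    case False
    then have "min i (Suc k) = i" "min i k = i" by auto
    with Suc False elim_Suc_index[OF assms, of k] show ?thesis by simp
  qed
qed simp

theorem lu_factorization:
  assumes M: "M \<in> carrier_mat n n" and ex: "lu_exists M"
  shows "M = lu_lower M * lu_upper M"
    and "lower_unitriangular (lu_lower M)" and "upper_triangular (lu_upper M)"
proof -
  from M have d: "dim_row M = n" "dim_col M = n" by auto
  show "lower_unitriangular (lu_lower M)"
    by (auto simp: lower_unitriangular_def lu_lower_def)
  show "upper_triangular (lu_upper M)"
    using elim_col_zero[OF M ex] by (auto simp: lu_upper_def d intro!: upper_triangularI)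
  show "M = lu_lower M * lu_upper M"
  proof (rule eq_matI)
    fix i j assume "i < dim_row (lu_lower M * lu_upper M)" "j < dim_col (lu_lower M * lu_upper M)"
    then have ij: "i < n" "j < n" by (auto simp: lu_lower_def lu_upper_def d)
    have "(lu_lower M * lu_upper M) $$ (i, j) = (\<Sum>l = 0..<n. lu_lower M $$ (i, l) * lu_upper M $$ (l, j))"
      using ij by (simp add: scalar_prod_def lu_lower_def lu_upper_def d)
    also have "\<dots> = (\<Sum>l < Suc i. lu_lower M $$ (i, l) * lu_upper M $$ (l, j))"
      using ij by (intro sum.mono_neutral_right) (auto simp: lu_lower_def d)
    also have "\<dots> = elim M i $$ (i, j) +
        (\<Sum>l < i. elim M l $$ (i, l) / elim M l $$ (l, l) * elim M l $$ (l, j))"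
    proof -
      have "lu_upper M $$ (l, j) = elim M l $$ (l, j)" if "l \<le> i" for l
        unfolding lu_upper_def d(1) using elim_row_final[of l M j "n - 1"] that ij d by simp
      then show ?thesis using ij by (simp add: lu_lower_def d)
    qed
    also have "\<dots> = M $$ (i, j)" using elim_telescope[of i M j i] ij d by simp
    finally show "M $$ (i, j) = (lu_lower M * lu_upper M) $$ (i, j)" by simp
  qed (auto simp: lu_lower_def lu_upper_def d)
qed

theorem lu_unique:
  assumes L: "L \<in> carrier_mat n n" "lower_unitriangular L"
    and U: "U \<in> carrier_mat n n" "upper_triangular U"
    and nz: "\<And>k. k < n - 1 \<Longrightarrow> U $$ (k, k) \<noteq> 0"
  shows "lu_exists (L * U)" and "lu_lower (L * U) = L" and "lu_upper (L * U) = U"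
proof -
  let ?M = "L * U"
  from L U have d: "dim_row L = n" "dim_col L = n" "dim_row U = n" "dim_col U = n" by auto
  have L1: "L $$ (i, i) = 1" if "i < n" for i
    using L(2) that d by (auto simp: lower_unitriangular_def)
  have L0: "L $$ (i, j) = 0" if "i < j" "j < n" for i j
    using L(2) that d by (auto simp: lower_unitriangular_def)
  have U0: "U $$ (i, j) = 0" if "j < i" "i < n" for i j
    using U(2) that d by auto
  have main: "elim ?M k $$ (i, j) = (if i < k then U $$ (i, j) else (\<Sum>l = k..<n. L $$ (i, l) * U $$ (l, j)))"
    if "k \<le> n - 1" "i < n" "j < n" for k i j
    using that
  proof (induction k arbitrary: i j)
    case 0
    then show ?case by (simp add: scalar_prod_def d)
  next
    case (Suc k)
    have kn: "k < n" and uk: "U $$ (k, k) \<noteq> 0" using Suc.prems nz by auto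
    have split: "(\<Sum>l = k..<n. f l) = f k + (\<Sum>l = Suc k..<n. f l)" for f :: "nat \<Rightarrow> 'a"
      using kn by (simp add: sum.atLeast_Suc_lessThan)
    have row: "(\<Sum>l = k..<n. L $$ (k, l) * U $$ (l, j)) = U $$ (k, j)" if "j < n" for j
      unfolding split using L0 L1[OF kn] that by simp
    have col: "(\<Sum>l = k..<n. L $$ (i, l) * U $$ (l, k)) = L $$ (i, k) * U $$ (k, k)" for i
      unfolding split using U0 by simp
    have "elim ?M (Suc k) $$ (i, j) = (if k < i then elim ?M k $$ (i, j) -
        elim ?M k $$ (i, k) / elim ?M k $$ (k, k) * elim ?M k $$ (k, j) else elim ?M k $$ (i, j))"
      using Suc.prems d by (intro elim_Suc_index) auto
    moreover have "elim ?M k $$ (k, j) = U $$ (k, j)" "elim ?M k $$ (k, k) = U $$ (k, k)"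
      using Suc kn row by auto
    moreover have "elim ?M k $$ (i, k) = L $$ (i, k) * U $$ (k, k)" if "k < i"
      using Suc.IH[of i k] Suc.prems kn col that by auto
    moreover have "elim ?M k $$ (i, j) = (\<Sum>l = k..<n. L $$ (i, l) * U $$ (l, j))" if "k < i"
      using Suc.IH[of i j] Suc.prems that by auto
    moreover have "elim ?M k $$ (i, j) = U $$ (i, j)" if "i \<le> k"
      using Suc.IH[of i j] Suc.prems that row by (cases "i = k") auto
    ultimately show ?case using uk by (auto simp: split)
  qed
  have fin: "(\<Sum>l = k..<n. L $$ (k, l) * U $$ (l, j)) = U $$ (k, j)" if "k < n" "j < n" for k j
    using that L0 L1[of k] by (simp add: sum.atLeast_Suc_lessThan)
  have piv: "elim ?M k $$ (k, k) = U $$ (k, k)" if "k < n" for k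
    using main[of k k k] fin that by auto
  show "lu_exists ?M" using piv nz d by (auto simp: lu_exists_def)
  show "lu_upper ?M = U"
  proof (rule eq_matI)
    fix i j assume "i < dim_row U" "j < dim_col U"
    then have ij: "i < n" "j < n" using d by auto
    have "i = n - 1" if "\<not> i < n - 1" using that ij by auto
    with main[of "n - 1" i j] fin[OF ij] ij d show "lu_upper ?M $$ (i, j) = U $$ (i, j)"
      by (auto simp: lu_upper_def split: if_splits)
  qed (auto simp: lu_upper_def d)
  show "lu_lower ?M = L"
  proof (rule eq_matI)
    fix i j assume "i < dim_row L" "j < dim_col L"
    then have ij: "i < n" "j < n" using d by auto
    have "elim ?M j $$ (i, j) / elim ?M j $$ (j, j) = L $$ (i, j)" if "j < i"
    proof -
      have "elim ?M j $$ (i, j) = (\<Sum>l = j..<n. L $$ (i, l) * U $$ (l, j))"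
        using main[of j i j] that ij by auto
      also have "\<dots> = L $$ (i, j) * U $$ (j, j)"
        using U0 ij by (simp add: sum.atLeast_Suc_lessThan)
      finally show ?thesis using piv[of j] nz[of j] ij that by simp
    qed
    then show "lu_lower ?M $$ (i, j) = L $$ (i, j)"
      using ij L0 L1 d by (auto simp: lu_lower_def)
  qed (auto simp: lu_lower_def d)
qed

end

theory Submission
  imports Defs "Jordan_Normal_Form.Determinant"
begin

text \<open>The last pivot \<open>p\<close> of an invertible matrix \<open>M\<close> is the reciprocal of the last entry of \<open>M\<^sup>-\<^sup>1 e\<^sub>n\<close>: elimination
  leaves the right-hand side \<open>e\<^sub>n\<close> of a linear system unchanged, because its entries above the last
  one vanish, so that the last equation of the eliminated system reads \<open>p w\<^sub>n = 1\<close>. For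
  \<open>M = A + \<epsilon> e\<^sub>i e\<^sub>j\<^sup>T\<close> with \<open>A\<close> invertible and \<open>B = A\<^sup>-\<^sup>1\<close>, the Sherman-Morrison formula gives such a
  solution; cleared of denominators, it is \<open>w = (1 + \<epsilon> B\<^sub>j\<^sub>i) B e\<^sub>n - \<epsilon> B\<^sub>j\<^sub>n B e\<^sub>i\<close> with
  \<open>M w = (1 + \<epsilon> B\<^sub>j\<^sub>i) e\<^sub>n\<close>. Hence
  \[ p = \frac{1 + \epsilon B_{ji}}{(1 + \epsilon B_{ji}) B_{nn} - \epsilon B_{jn} B_{ni}}, \]
  also when \<open>M\<close> is singular (lemma \<open>last_pivot_rank_one_update\<close>).

  It remains to compute the columns \<open>i\<close> and \<open>n\<close> of \<open>A\<^sup>-\<^sup>1\<close>. The whole left factor of \<open>A\<close> is the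
  unitriangular matrix with all entries \<open>-1\<close> below the diagonal. Forward substitution with it doubles
  at each step, so that column \<open>i\<close> of its inverse is \<open>(0, \<dots>, 0, 1, 1, 2, 4, \<dots>)\<close>. Back substitution
  with the right factor first subtracts a multiple of \<open>(1, 2, 4, \<dots>)\<close>, which for \<open>i < n\<close> cancels every
  entry between the \<open>i\<close>-th and the last; what remains is multiplied by the inverse of the triangular
  matrix \<open>Uhat\<close>, which is triangular too (lemma \<open>inverse_column\<close>). Substituting these entries into
  the quotient gives all five formulas.\<close>

section \<open>Elimination and the last pivot\<close>

lemma mult_mat_vec_sum:
  assumes "M \<in> carrier_mat m n" "w \<in> carrier_vec n" "r < m"
  shows "(M *\<^sub>v w) $ r = (\<Sum>c<n. M $$ (r, c) * w $ c)"
  using assms by (simp add: scalar_prod_def lessThan_atLeast0)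

text \<open>The rows are numbered from 0. Row \<open>k < n - 1\<close> of the system has right-hand side 0,
  so subtracting multiples of it from the rows below does not change the right-hand side.\<close>

lemma elim_preserves_system:
  fixes M :: "'a::field mat"
  assumes M: "M \<in> carrier_mat n n" and w: "w \<in> carrier_vec n"
    and Mw: "M *\<^sub>v w = x \<cdot>\<^sub>v unit_vec n (n - 1)" and k: "k \<le> n - 1"
  shows "elim M k *\<^sub>v w = x \<cdot>\<^sub>v unit_vec n (n - 1)"
  using k
proof (induction k)
  case 0
  with Mw show ?case by simp
next
  case (Suc k)
  have d: "dim_row M = n" "dim_col M = n" using M by auto
  have E: "elim M l \<in> carrier_mat n n" for l using d by (intro carrier_matI) auto
  have IH: "elim M k *\<^sub>v w = x \<cdot>\<^sub>v unit_vec n (n - 1)" using Suc by simp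
  have kn: "k < n - 1" using Suc.prems by simp
  have row: "(\<Sum>c<n. elim M k $$ (k, c) * w $ c) = 0"
    using kn by (simp add: mult_mat_vec_sum[OF E w, symmetric] IH)
  have step: "(elim M (Suc k) *\<^sub>v w) $ r = (elim M k *\<^sub>v w) $ r" if r: "r < n" for r
  proof (cases "k < r")
    case True
    let ?q = "elim M k $$ (r, k) / elim M k $$ (k, k)"
    have "(elim M (Suc k) *\<^sub>v w) $ r =
        (\<Sum>c<n. elim M k $$ (r, c) * w $ c - ?q * (elim M k $$ (k, c) * w $ c))"
      unfolding mult_mat_vec_sum[OF E w r]
      using r True d
      by (intro sum.cong refl, subst elim_Suc_index) (auto simp: left_diff_distrib)
    also have "\<dots> = (\<Sum>c<n. elim M k $$ (r, c) * w $ c)"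
      unfolding sum_subtractf sum_distrib_left[symmetric] row by simp
    finally show ?thesis unfolding mult_mat_vec_sum[OF E w r] .
  next
    case False
    show ?thesis
      unfolding mult_mat_vec_sum[OF E w r]
      using False r d by (intro sum.cong refl, subst elim_Suc_index) auto
  qed
  have "elim M (Suc k) *\<^sub>v w = elim M k *\<^sub>v w"
    using step d by (intro eq_vecI) (auto simp del: elim.simps index_mult_mat_vec)
  with IH show ?case by (simp only:)
qed

lemma lu_upper_mult_vec_sum:
  fixes M :: "'a::field mat"
  assumes M: "M \<in> carrier_mat n n" and ex: "lu_exists M" and w: "w \<in> carrier_vec n"
    and Mw: "M *\<^sub>v w = x \<cdot>\<^sub>v unit_vec n (n - 1)" and r: "r < n"
  shows "(\<Sum>c = r..<n. lu_upper M $$ (r, c) * w $ c) = (if r = n - 1 then x else 0)"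
proof -
  have d: "dim_row M = n" "dim_col M = n" using M by auto
  have U: "lu_upper M \<in> carrier_mat n n"
    using d by (intro carrier_matI) (auto simp: lu_upper_def)
  have "(\<Sum>c = r..<n. lu_upper M $$ (r, c) * w $ c) = (\<Sum>c<n. lu_upper M $$ (r, c) * w $ c)"
    using elim_col_zero[OF M ex, of "n - 1"] r
    by (intro sum.mono_neutral_left) (auto simp: lu_upper_def d)
  also have "\<dots> = (lu_upper M *\<^sub>v w) $ r" using mult_mat_vec_sum[OF U w r] by simp
  also have "lu_upper M *\<^sub>v w = x \<cdot>\<^sub>v unit_vec n (n - 1)"
    using elim_preserves_system[OF M w Mw, of "n - 1"] by (simp add: lu_upper_def d)
  finally show ?thesis using r by auto
qed

lemma last_pivot_mult:
  fixes M :: "'a::field mat"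
  assumes M: "M \<in> carrier_mat n n" and n: "0 < n" and ex: "lu_exists M" and w: "w \<in> carrier_vec n"
    and Mw: "M *\<^sub>v w = x \<cdot>\<^sub>v unit_vec n (n - 1)"
  shows "lu_last_pivot M * w $ (n - 1) = x"
proof -
  have "{n - 1..<n} = {n - 1}" using n by auto
  then show ?thesis
    using lu_upper_mult_vec_sum[OF M ex w Mw, of "n - 1"] n M by (simp add: lu_last_pivot_def)
qed

text \<open>Back substitution: the pivots other than the last are nonzero.\<close>

lemma solution_zero_if_last_zero:
  fixes M :: "'a::field mat"
  assumes M: "M \<in> carrier_mat n n" and ex: "lu_exists M" and w: "w \<in> carrier_vec n"
    and Mw: "M *\<^sub>v w = x \<cdot>\<^sub>v unit_vec n (n - 1)" and last: "w $ (n - 1) = 0"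
  shows "w = 0\<^sub>v n"
proof -
  have d: "dim_row M = n" "dim_col M = n" using M by auto
  have "w $ r = 0" if "r < n" for r
    using that
  proof (induction "n - r" arbitrary: r rule: less_induct)
    case less
    show ?case
    proof (cases "r = n - 1")
      case False
      then have r: "r < n - 1" using less.prems by simp
      have "lu_upper M $$ (r, r) = elim M r $$ (r, r)"
        using elim_row_final[of r M r "n - 1"] r d by (simp add: lu_upper_def)
      then have nz: "lu_upper M $$ (r, r) \<noteq> 0" using ex r d by (simp add: lu_exists_def)
      have "w $ c = 0" if "c \<in> {Suc r..<n}" for c using that less.hyps[of c] r by auto
      then have "(\<Sum>c = r..<n. lu_upper M $$ (r, c) * w $ c) = lu_upper M $$ (r, r) * w $ r"
        using less.prems by (simp add: sum.atLeast_Suc_lessThan)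
      with lu_upper_mult_vec_sum[OF M ex w Mw less.prems] False nz show ?thesis by simp
    qed (use last in simp)
  qed
  then show ?thesis using w by (intro eq_vecI) auto
qed

lemma rank_one_update_mult_vec:
  fixes A :: "'a::comm_ring_1 mat"
  assumes A: "A \<in> carrier_mat n n" and i: "i < n" and j: "j < n" and w: "w \<in> carrier_vec n"
  shows "(A + e \<cdot>\<^sub>m (mat_of_col (unit_vec n i) * mat_of_row (unit_vec n j))) *\<^sub>v w =
    A *\<^sub>v w + (e * w $ j) \<cdot>\<^sub>v unit_vec n i"
proof -
  let ?P = "mat_of_col (unit_vec n i) * mat_of_row (unit_vec n j) :: 'a mat"
  have d: "dim_row (mat_of_col (unit_vec n i) :: 'a mat) = n"
    "dim_col (mat_of_col (unit_vec n i) :: 'a mat) = 1"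
    by (auto simp: mat_of_col_def)
  have P: "?P \<in> carrier_mat n n" using d by (intro carrier_matI) simp_all
  have entry: "?P $$ (r, c) = (if r = i \<and> c = j then 1 else 0)" if "r < n" "c < n" for r c
  proof -
    have "mat_of_col (unit_vec n i) $$ (r, 0) = (unit_vec n i $ r :: 'a)"
      using that i by (simp add: mat_of_col_def mat_of_cols_def)
    moreover have "mat_of_row (unit_vec n j) $$ (0, c) = (unit_vec n j $ c :: 'a)"
      using that by simp
    ultimately show ?thesis using that i j d by (simp add: scalar_prod_def)
  qed
  have "?P *\<^sub>v w = w $ j \<cdot>\<^sub>v unit_vec n i"
  proof (rule eq_vecI)
    fix r assume "r < dim_vec (w $ j \<cdot>\<^sub>v unit_vec n i)"
    then have r: "r < n" by simp
    have "(?P *\<^sub>v w) $ r = (\<Sum>c<n. (if c = j then (if r = i then w $ j else 0) else 0))"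
      unfolding mult_mat_vec_sum[OF P w r]
      by (intro sum.cong refl) (simp add: entry r del: index_mult_mat)
    also have "\<dots> = (w $ j \<cdot>\<^sub>v unit_vec n i) $ r" using r i j by simp
    finally show "(?P *\<^sub>v w) $ r = (w $ j \<cdot>\<^sub>v unit_vec n i) $ r" .
  qed (use d in simp)
  then have "e \<cdot>\<^sub>v (?P *\<^sub>v w) = (e * w $ j) \<cdot>\<^sub>v unit_vec n i" by (simp only: smult_smult_assoc)
  moreover have "(A + e \<cdot>\<^sub>m ?P) *\<^sub>v w = A *\<^sub>v w + (e \<cdot>\<^sub>m ?P) *\<^sub>v w"
    by (rule add_mult_distrib_mat_vec[OF A smult_carrier_mat[OF P] w])
  moreover have "(e \<cdot>\<^sub>m ?P) *\<^sub>v w = e \<cdot>\<^sub>v (?P *\<^sub>v w)"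
    using P w by (intro eq_vecI) auto
  ultimately show ?thesis by (simp only:)
qed

text \<open>Here \<open>a\<close> and \<open>b\<close> are the last and the \<open>i\<close>-th column of \<open>A\<^sup>-\<^sup>1\<close>. The denominator is the last
  entry of the solution \<open>w\<close> of \<open>M w = (1 + \<epsilon> b\<^sub>j) e\<^sub>n\<close>. If it were 0, then \<open>w = 0\<close> and so
  \<open>\<epsilon> a\<^sub>j b = 0\<close>; then \<open>M a = e\<^sub>n\<close>, which makes the last pivot nonzero and \<open>M\<close> injective, whereas
  \<open>M b = (1 + \<epsilon> b\<^sub>j) e\<^sub>i = 0\<close>.\<close>

lemma last_pivot_rank_one_update:
  fixes A :: "'a::field mat"
  defines "M \<equiv> \<lambda>e i j n. A + e \<cdot>\<^sub>m (mat_of_col (unit_vec n i) * mat_of_row (unit_vec n j))"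
  assumes A: "A \<in> carrier_mat n n" and i: "i < n" and j: "j < n"
    and a: "a \<in> carrier_vec n" and Aa: "A *\<^sub>v a = unit_vec n (n - 1)"
    and b: "b \<in> carrier_vec n" and Ab: "A *\<^sub>v b = unit_vec n i"
    and ex: "lu_exists (M e i j n)"
  shows "lu_last_pivot (M e i j n) =
    (1 + e * b $ j) / ((1 + e * b $ j) * a $ (n - 1) - e * a $ j * b $ (n - 1))"
proof -
  let ?M = "M e i j n"
  let ?x = "1 + e * b $ j"
  let ?w = "?x \<cdot>\<^sub>v a + (- (e * a $ j)) \<cdot>\<^sub>v b"
  have n: "0 < n" using i by simp
  have C: "?M \<in> carrier_mat n n"
    unfolding M_def using A by (intro carrier_matI) (simp_all add: mat_of_col_def)
  have Mv: "?M *\<^sub>v v = A *\<^sub>v v + (e * v $ j) \<cdot>\<^sub>v unit_vec n i" if "v \<in> carrier_vec n" for v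
    unfolding M_def by (rule rank_one_update_mult_vec[OF A i j that])
  have w: "?w \<in> carrier_vec n" using a b by auto
  have Aw: "A *\<^sub>v ?w = ?x \<cdot>\<^sub>v unit_vec n (n - 1) + (- (e * a $ j)) \<cdot>\<^sub>v unit_vec n i"
    using a b Aa Ab by (simp add: mult_add_distrib_mat_vec[OF A] mult_mat_vec[OF A])
  have Mw: "?M *\<^sub>v ?w = ?x \<cdot>\<^sub>v unit_vec n (n - 1)"
    unfolding Mv[OF w] Aw using a b i j by (intro eq_vecI) (auto simp: algebra_simps)
  have wn: "?w $ (n - 1) = ?x * a $ (n - 1) - e * a $ j * b $ (n - 1)"
    using a b n by auto
  have "?w $ (n - 1) \<noteq> 0"
  proof
    assume w0: "?w $ (n - 1) = 0"
    have w_zero: "?w = 0\<^sub>v n" by (rule solution_zero_if_last_zero[OF C ex w Mw w0])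
    have x0: "?x = 0" using last_pivot_mult[OF C n ex w Mw] w0 by simp
    have b0: "b \<noteq> 0\<^sub>v n"
    proof
      assume "b = 0\<^sub>v n"
      then have "A *\<^sub>v b = 0\<^sub>v n" using A by auto
      with Ab unit_vec_nonzero[OF i] show False by metis
    qed
    have "e * a $ j = 0"
    proof (rule ccontr)
      assume nz: "e * a $ j \<noteq> 0"
      have "b $ r = 0" if "r < n" for r
        using arg_cong[OF w_zero, of "\<lambda>v. v $ r"] that x0 nz a b by auto
      then have "b = 0\<^sub>v n" using b by (intro eq_vecI) auto
      with b0 show False ..
    qed
    then have "?M *\<^sub>v a = 1 \<cdot>\<^sub>v unit_vec n (n - 1)"
      unfolding Mv[OF a] Aa by (intro eq_vecI) auto
    from last_pivot_mult[OF C n ex a this] have p0: "lu_last_pivot ?M \<noteq> 0" by auto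
    have Mb: "?M *\<^sub>v b = 0 \<cdot>\<^sub>v unit_vec n (n - 1)"
    proof -
      have "?M *\<^sub>v b = ?x \<cdot>\<^sub>v unit_vec n i"
        unfolding Mv[OF b] Ab using i by (intro eq_vecI) (auto simp: algebra_simps)
      then show ?thesis unfolding x0 by (simp only:) (intro eq_vecI, auto)
    qed
    have "b $ (n - 1) = 0" using last_pivot_mult[OF C n ex b Mb] p0 by simp
    with solution_zero_if_last_zero[OF C ex b Mb] b0 show False by simp
  qed
  with last_pivot_mult[OF C n ex w Mw] show ?thesis unfolding wn by (simp add: field_simps)
qed

section \<open>Columns of the inverse\<close>

text \<open>Entry \<open>k\<close> of column \<open>i\<close> of the inverse of the lower unitriangular matrix, of any order, with
  all entries \<open>-1\<close> below the diagonal.\<close>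

definition lower_inv_entry :: "nat \<Rightarrow> nat \<Rightarrow> real" where
  "lower_inv_entry i k = (if k < i then 0 else if k = i then 1 else 2 ^ (k - i - 1))"

lemma sum_lower_inv_entry:
  "(\<Sum>k<r. lower_inv_entry i k) = lower_inv_entry i r - (if r = i then 1 else 0)"
proof (induction r)
  case (Suc r)
  have "lower_inv_entry i (Suc r) = 2 * lower_inv_entry i r" if "i < r"
    using that by (simp add: lower_inv_entry_def Suc_diff_Suc flip: power_Suc)
  moreover have "lower_inv_entry i (Suc r) = 1" "lower_inv_entry i r = 1" if "i = r"
    using that by (simp_all add: lower_inv_entry_def)
  ultimately show ?case
    unfolding sum.lessThan_Suc Suc.IH by (auto simp: lower_inv_entry_def)
qed (simp add: lower_inv_entry_def)

text \<open>What is left of the right-hand side of the triangular system with the right factor of \<open>A\<close>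
  once the last unknown, \<open>lower_inv_entry i m / 2 ^ m\<close>, is substituted into the first \<open>m\<close> equations.\<close>

definition reduced_rhs :: "nat \<Rightarrow> nat \<Rightarrow> real vec" where
  "reduced_rhs m i = vec m (\<lambda>k. lower_inv_entry i k - lower_inv_entry i m / 2 ^ m * 2 ^ k)"

definition inv_col :: "real mat \<Rightarrow> nat \<Rightarrow> nat \<Rightarrow> real vec" where
  "inv_col V m i = (V *\<^sub>v reduced_rhs m i) @\<^sub>v vec 1 (\<lambda>_. lower_inv_entry i m / 2 ^ m)"

lemma inverse_column:
  assumes L: "L \<in> carrier_mat m m" "lower_unitriangular L"
    and L_minus_one: "\<And>r c. c < r \<Longrightarrow> r < m \<Longrightarrow> L $$ (r, c) = -1"
    and U: "U \<in> carrier_mat m m" and V: "V \<in> carrier_mat m m" "U * V = 1\<^sub>m m"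
    and i: "i \<le> m"
  shows "(four_block_mat L (0\<^sub>m m 1) (mat_of_row (- ones_vec m)) (1\<^sub>m 1) *
      four_block_mat U (mat_of_col (pow2_vec m)) (0\<^sub>m 1 m) (2 ^ m \<cdot>\<^sub>m 1\<^sub>m 1)) *\<^sub>v inv_col V m i =
    unit_vec (Suc m) i"
proof -
  let ?LL = "four_block_mat L (0\<^sub>m m 1) (mat_of_row (- ones_vec m)) (1\<^sub>m 1)"
  let ?UU = "four_block_mat U (mat_of_col (pow2_vec m)) (0\<^sub>m 1 m) (2 ^ m \<cdot>\<^sub>m 1\<^sub>m 1)"
  let ?z = "reduced_rhs m i"
  let ?t = "vec 1 (\<lambda>_. lower_inv_entry i m / 2 ^ m) :: real vec"
  let ?x = "vec m (lower_inv_entry i)"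
  let ?s = "vec 1 (\<lambda>_. lower_inv_entry i m)"
  have ones: "mat_of_row (- ones_vec m) \<in> carrier_mat 1 m"
    by (intro carrier_matI) (simp_all add: ones_vec_def)
  have pow: "mat_of_col (pow2_vec m) \<in> carrier_mat m 1"
    by (intro carrier_matI) (simp_all add: mat_of_col_def pow2_vec_def)
  have z: "?z \<in> carrier_vec m" and t: "?t \<in> carrier_vec 1" by (simp_all add: reduced_rhs_def)
  have x: "?x \<in> carrier_vec m" and s: "?s \<in> carrier_vec 1" by auto
  have LL: "?LL \<in> carrier_mat (Suc m) (Suc m)" and UU: "?UU \<in> carrier_mat (Suc m) (Suc m)"
    using L(1) U by (auto intro!: carrier_matI)
  have ic: "inv_col V m i \<in> carrier_vec (Suc m)"
    using V(1) by (intro carrier_vecI) (simp add: inv_col_def)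
  have "?UU *\<^sub>v inv_col V m i =
      (U *\<^sub>v (V *\<^sub>v ?z) + mat_of_col (pow2_vec m) *\<^sub>v ?t) @\<^sub>v
      (0\<^sub>m 1 m *\<^sub>v (V *\<^sub>v ?z) + (2 ^ m \<cdot>\<^sub>m 1\<^sub>m 1) *\<^sub>v ?t)"
    unfolding inv_col_def using U V z t pow by (intro four_block_mat_mult_vec) auto
  also have "U *\<^sub>v (V *\<^sub>v ?z) = ?z"
    using assoc_mult_mat_vec[OF U V(1) z] V(2) z by simp
  also have "?z + mat_of_col (pow2_vec m) *\<^sub>v ?t = ?x"
    by (intro eq_vecI)
      (auto simp: reduced_rhs_def mat_of_col_def pow2_vec_def mat_of_cols_def scalar_prod_def)
  also have "0\<^sub>m 1 m *\<^sub>v (V *\<^sub>v ?z) + (2 ^ m \<cdot>\<^sub>m 1\<^sub>m 1) *\<^sub>v ?t = ?s"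
    using V(1) z by (intro eq_vecI) (auto simp: scalar_prod_def)
  finally have 1: "?UU *\<^sub>v inv_col V m i = ?x @\<^sub>v ?s" .
  have "?LL *\<^sub>v (?x @\<^sub>v ?s) =
      (L *\<^sub>v ?x + 0\<^sub>m m 1 *\<^sub>v ?s) @\<^sub>v (mat_of_row (- ones_vec m) *\<^sub>v ?x + 1\<^sub>m 1 *\<^sub>v ?s)"
    using L x s ones by (intro four_block_mat_mult_vec) auto
  also have "\<dots> = unit_vec (Suc m) i"
  proof (rule eq_vecI)
    fix r assume "r < dim_vec (unit_vec (Suc m) i :: real vec)"
    then have r: "r < Suc m" by simp
    show "((L *\<^sub>v ?x + 0\<^sub>m m 1 *\<^sub>v ?s) @\<^sub>v (mat_of_row (- ones_vec m) *\<^sub>v ?x + 1\<^sub>m 1 *\<^sub>v ?s)) $ r =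
        unit_vec (Suc m) i $ r"
    proof (cases "r < m")
      case True
      have "(L *\<^sub>v ?x) $ r = (\<Sum>k<m. L $$ (r, k) * lower_inv_entry i k)"
        using True by (subst mult_mat_vec_sum[OF L(1) x]) auto
      also have "\<dots> = (\<Sum>k<Suc r. L $$ (r, k) * lower_inv_entry i k)"
        using True L by (intro sum.mono_neutral_right) (auto simp: lower_unitriangular_def)
      also have "\<dots> = lower_inv_entry i r + (\<Sum>k<r. - lower_inv_entry i k)"
        using True L L_minus_one by (auto simp: lower_unitriangular_def)
      also have "\<dots> = (if r = i then 1 else 0)"
        by (simp add: sum_negf sum_lower_inv_entry)
      finally show ?thesis
        using True L(1) x i r by (simp del: index_mult_mat_vec) (simp add: scalar_prod_def)
    next
      case False
      with r have "r = m" by simp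
      moreover have "(mat_of_row (- ones_vec m) *\<^sub>v ?x) $ 0 = - (\<Sum>k<m. lower_inv_entry i k)"
        by (subst mult_mat_vec_sum[OF ones x]) (auto simp: ones_vec_def sum_negf)
      ultimately show ?thesis
        using L(1) x i by (simp del: index_mult_mat_vec add: sum_lower_inv_entry)
    qed
  qed (use L in auto)
  finally have "?LL *\<^sub>v (?x @\<^sub>v ?s) = unit_vec (Suc m) i" .
  then show ?thesis using 1 assoc_mult_mat_vec[OF LL UU ic] by simp
qed

text \<open>Column \<open>k\<close> of \<open>V * U = 1\<close> determines the entries
  of \<open>V\<close> in column \<open>k\<close> from those to their left, since \<open>U\<close> has nonzero diagonal entries.\<close>

lemma upper_triangular_left_inverse_zero:
  fixes U :: "'a::field mat"
  assumes U: "U \<in> carrier_mat m m" "upper_triangular U"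
    and V: "V \<in> carrier_mat m m" "V * U = 1\<^sub>m m"
    and "k < j" "j < m"
  shows "V $$ (j, k) = 0"
  using assms(5)
proof (induction k rule: less_induct)
  case (less k)
  have km: "k < m" using less.prems assms(6) by simp
  have "det V * det U = 1" using det_mult[OF V(1) U(1)] V(2) by simp
  then have "det U \<noteq> 0" by auto
  then have nz: "U $$ (k, k) \<noteq> 0"
    using upper_triangular_imp_det_eq_0_iff[OF U] km U(1) by (force simp: diag_mat_def)
  have "(V * U) $$ (j, k) = (\<Sum>l<m. V $$ (j, l) * U $$ (l, k))"
    using U(1) V(1) assms(6) km by (simp add: scalar_prod_def lessThan_atLeast0)
  also have "\<dots> = (\<Sum>l\<in>{k}. V $$ (j, l) * U $$ (l, k))"
  proof (intro sum.mono_neutral_right ballI)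
    fix l assume "l \<in> {..<m} - {k}"
    then consider "l < k" | "k < l" "l < m" by fastforce
    then show "V $$ (j, l) * U $$ (l, k) = 0"
    proof cases
      case 1
      then show ?thesis using less by simp
    next
      case 2
      then show ?thesis using upper_triangularD[OF U(2), of k l] U(1) by simp
    qed
  qed (use km in auto)
  finally show ?case using V(2) nz less.prems assms(6) km by simp
qed

text \<open>An invertible matrix is a unit of the matrix ring, the notion in which the specification of
  \<open>mat_inverse\<close> is expressed.\<close>

lemma mat_inverse_invertible:
  fixes U :: "'a::field mat"
  assumes U: "U \<in> carrier_mat m m" "invertible_mat U"
  defines "V \<equiv> the (mat_inverse U)"
  shows "V \<in> carrier_mat m m" "U * V = 1\<^sub>m m" "V * U = 1\<^sub>m m"
proof -
  obtain B where B: "inverts_mat U B" "inverts_mat B U"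
    using U(2) by (auto simp: invertible_mat_def)
  have "dim_col B = m" using arg_cong[OF B(1)[unfolded inverts_mat_def], of dim_col] U(1) by simp
  moreover have "dim_row B = m"
    using arg_cong[OF B(2)[unfolded inverts_mat_def], of dim_col] U(1) by simp
  ultimately have "B \<in> carrier_mat m m" "U * B = 1\<^sub>m m" "B * U = 1\<^sub>m m"
    using U(1) B by (auto simp: inverts_mat_def)
  then have "U \<in> Units (ring_mat TYPE('a) m ())"
    using U(1) unfolding Units_def ring_mat_simps by blast
  then obtain W where "mat_inverse U = Some W" using mat_inverse(1)[OF U(1), of "()"] by (cases "mat_inverse U") auto
  with mat_inverse(2)[OF U(1) this] show "V \<in> carrier_mat m m" "U * V = 1\<^sub>m m" "V * U = 1\<^sub>m m"
    by (auto simp: V_def)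
qed

lemma inv_col_last:
  assumes "V \<in> carrier_mat m m"
  shows "inv_col V m i $ m = lower_inv_entry i m / 2 ^ m"
  using assms by (simp add: inv_col_def)

lemma inv_col_entry:
  assumes V: "V \<in> carrier_mat m m" and V0: "\<forall>k<j. V $$ (j, k) = 0" and j: "j < m"
  shows "inv_col V m i $ j =
    (\<Sum>k = j..<m. V $$ (j, k) * (lower_inv_entry i k - lower_inv_entry i m / 2 ^ m * 2 ^ k))"
proof -
  have z: "reduced_rhs m i \<in> carrier_vec m" by (simp add: reduced_rhs_def)
  have "inv_col V m i $ j = (V *\<^sub>v reduced_rhs m i) $ j"
    using V j by (simp add: inv_col_def)
  also have "\<dots> = (\<Sum>k<m. V $$ (j, k) *
      (lower_inv_entry i k - lower_inv_entry i m / 2 ^ m * 2 ^ k))"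
    unfolding mult_mat_vec_sum[OF V z j] by (simp add: reduced_rhs_def)
  also have "\<dots> = (\<Sum>k = j..<m. V $$ (j, k) *
      (lower_inv_entry i k - lower_inv_entry i m / 2 ^ m * 2 ^ k))"
    using V0 by (intro sum.mono_neutral_right) auto
  finally show ?thesis .
qed

lemma inv_col_entry_last:
  assumes "V \<in> carrier_mat m m" "\<forall>k<j. V $$ (j, k) = 0" "j < m"
  shows "inv_col V m m $ j = - (\<Sum>k = j..<m. 2 ^ k / 2 ^ m * V $$ (j, k))"
  unfolding inv_col_entry[OF assms] sum_negf[symmetric]
  by (intro sum.cong) (auto simp: lower_inv_entry_def)

text \<open>For \<open>i < m\<close> the multiple of \<open>(1, 2, 4, \<dots>)\<close> that is subtracted agrees with column \<open>i\<close> of the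
  lower inverse beyond position \<open>i\<close>, so only the positions up to \<open>i\<close> contribute.\<close>

lemma inv_col_entry_less:
  assumes "V \<in> carrier_mat m m" "\<forall>k<j. V $$ (j, k) = 0" "j < m" and i: "i < m"
  shows "inv_col V m i $ j =
    (if i < j then 0 else 1 / 2 * (V $$ (j, i) - (\<Sum>k = j..<i. 2 ^ k / 2 ^ i * V $$ (j, k))))"
proof -
  have "lower_inv_entry i m / 2 ^ m = 1 / 2 ^ Suc i"
    using i by (simp add: lower_inv_entry_def power_diff)
  then have c: "lower_inv_entry i k - lower_inv_entry i m / 2 ^ m * 2 ^ k =
      (if k < i then - (2 ^ k / 2 ^ i) / 2 else if k = i then 1 / 2 else 0)" for k
    by (simp add: lower_inv_entry_def power_diff)
  show ?thesis
  proof (cases "i < j")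
    case True
    then show ?thesis unfolding inv_col_entry[OF assms(1-3)] c by simp
  next
    case False
    have "inv_col V m i $ j = (\<Sum>k = j..<Suc i. V $$ (j, k) *
        (if k < i then - (2 ^ k / 2 ^ i) / 2 else if k = i then 1 / 2 else 0))"
      unfolding inv_col_entry[OF assms(1-3)] c
      using i by (intro sum.mono_neutral_right) auto
    also have "\<dots> = (\<Sum>k = j..<i. V $$ (j, k) * (- (2 ^ k / 2 ^ i) / 2)) + V $$ (j, i) / 2"
      using False by simp
    also have "(\<Sum>k = j..<i. V $$ (j, k) * (- (2 ^ k / 2 ^ i) / 2)) =
        - 1 / 2 * (\<Sum>k = j..<i. 2 ^ k / 2 ^ i * V $$ (j, k))"
      unfolding sum_distrib_left by (intro sum.cong) (simp_all add: mult_ac)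
    finally show ?thesis using False by (simp add: right_diff_distrib)
  qed
qed

section \<open>The pivot formulas\<close>

text \<open>The pivot formulas count entries backwards from position \<open>q\<close>, the inverse columns forwards.\<close>

lemma sum_powi_reindex:
  fixes f :: "nat \<Rightarrow> real"
  shows "(\<Sum>l = 1..q - p. 2 powi (- int l) * f (q - l)) = (\<Sum>k = p..<q. 2 ^ k / 2 ^ q * f k)"
proof (rule sum.reindex_bij_witness[of _ "\<lambda>k. q - k" "\<lambda>l. q - l"])
  fix l assume "l \<in> {1..q - p}"
  then show "2 ^ (q - l) / 2 ^ q * f (q - l) = 2 powi (- int l) * f (q - l)"
    by (auto simp: power_int_minus field_simps simp flip: power_add)
qed auto

theorem theorem2p3:
  fixes n i j :: nat and \<epsilon> p :: real and A Lhat Uhat V :: "real mat"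
  assumes n: "n \<ge> 2"
    and A_GL: "A \<in> carrier_mat n n" "invertible_mat A"
    and A_norm: "max_norm A = 1"
    and A_form: "A =
        four_block_mat Lhat (0\<^sub>m (n - 1) 1)
                       (mat_of_row (- ones_vec (n - 1))) (1\<^sub>m 1) *
        four_block_mat Uhat (mat_of_col (pow2_vec (n - 1)))
                       (0\<^sub>m 1 (n - 1)) (2 ^ (n - 1) \<cdot>\<^sub>m 1\<^sub>m 1)"
    and Lhat_GL: "Lhat \<in> carrier_mat (n - 1) (n - 1)" "invertible_mat Lhat"
    and Lhat_tri: "lower_unitriangular Lhat"
    and Lhat_minus_one: "\<And>r c. c < r \<Longrightarrow> r < n - 1 \<Longrightarrow> Lhat $$ (r, c) = -1"
    and Uhat_GL: "Uhat \<in> carrier_mat (n - 1) (n - 1)" "invertible_mat Uhat"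
    and Uhat_tri: "upper_triangular Uhat"
    and LU_norm: "max_norm (Lhat * Uhat) \<le> 1"
    and oneU_norm: "inf_norm_vec (row (mat_of_row (ones_vec (n - 1)) * Uhat) 0) \<le> 1"
    and V: "V = the (mat_inverse Uhat)"
    and ij: "1 \<le> i" "i \<le> n" "1 \<le> j" "j \<le> n"
    and LU_exists: "lu_exists
        (A + \<epsilon> \<cdot>\<^sub>m (mat_of_col (unit_vec n (i - 1)) * mat_of_row (unit_vec n (j - 1))))"
    and p: "p = lu_last_pivot
        (A + \<epsilon> \<cdot>\<^sub>m (mat_of_col (unit_vec n (i - 1)) * mat_of_row (unit_vec n (j - 1))))"
  shows "(i < j \<and> j < n \<longrightarrow>
            p = 1 / (2 powi (1 - int n)
                     + \<epsilon> * 2 powi (- int i) * (\<Sum>l = 1..n - j. 2 powi (- int l) * entry1 V j (n - l))))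
       \<and> (j \<le> i \<and> i < n \<longrightarrow>
            p = (1 + 1 / 2 * \<epsilon> * (entry1 V j i - (\<Sum>l = 1..i - j. 2 powi (- int l) * entry1 V j (i - l))))
                / (2 powi (1 - int n)
                   + \<epsilon> * (2 powi (1 - int n) * entry1 V j i
                          + 2 powi (- int i) * (\<Sum>l = 1..n - i - 1. 2 powi (- int l) * entry1 V j (n - l)))))
       \<and> (i < n \<and> j = n \<longrightarrow> p = 2 ^ (n - 1) * (1 + \<epsilon> * 2 powi (- int i)))
       \<and> (i = n \<and> j < n \<longrightarrow>
            p = 2 ^ (n - 1) * (1 - \<epsilon> * (\<Sum>l = 1..n - j. 2 powi (- int l) * entry1 V j (n - l))))
       \<and> (i = n \<and> j = n \<longrightarrow> p = 2 ^ (n - 1) + \<epsilon>)"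
proof -
  obtain m where nm: "n = Suc m" and m: "0 < m" using n by (cases n) auto
  obtain i' where i': "i = Suc i'" "i' \<le> m" using ij nm by (cases i) auto
  obtain j' where j': "j = Suc j'" "j' \<le> m" using ij nm by (cases j) auto
  have L: "Lhat \<in> carrier_mat m m" and U: "Uhat \<in> carrier_mat m m"
    using Lhat_GL Uhat_GL nm by auto
  note Vinv = mat_inverse_invertible[OF U Uhat_GL(2), folded V]
  have V0: "V $$ (r, k) = 0" if "k < r" "r < m" for r k
    by (rule upper_triangular_left_inverse_zero[OF U Uhat_tri Vinv(1,3) that])
  define a where "a = inv_col V m m"
  define b where "b = inv_col V m i'"
  have A: "A *\<^sub>v inv_col V m k = unit_vec n k" if "k \<le> m" for k
    using inverse_column[OF L Lhat_tri _ U Vinv(1,2) that] Lhat_minus_one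
    unfolding A_form nm by simp
  have car: "inv_col V m k \<in> carrier_vec n" for k
    using Vinv(1) by (intro carrier_vecI) (simp add: inv_col_def nm)
  have "p = (1 + \<epsilon> * b $ j') / ((1 + \<epsilon> * b $ j') * a $ m - \<epsilon> * a $ j' * b $ m)"
    unfolding p a_def b_def
    using last_pivot_rank_one_update[OF A_GL(1) _ _ car _ car,
      where i = i' and j = j' and e = \<epsilon>] A LU_exists i' j' nm
    by simp
  moreover have an: "a $ m = 1 / 2 ^ m"
    by (simp add: a_def inv_col_last[OF Vinv(1)] lower_inv_entry_def)
  ultimately have p_eq: "p = (1 + \<epsilon> * b $ j') / ((1 + \<epsilon> * b $ j') / 2 ^ m - \<epsilon> * a $ j' * b $ m)"
    by simp
  have bn: "b $ m = 1 / 2 ^ i" if "i < n"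
    using that i' nm by (simp add: b_def inv_col_last[OF Vinv(1)] lower_inv_entry_def power_diff)
  \<comment> \<open>With rows and columns numbered from 0, \<open>T\<close> is the sum up to the last column of \<open>V\<close>,
    and \<open>S\<close> and \<open>R\<close> are its parts before and after position \<open>i'\<close>, with \<open>S\<close> scaled to end at \<open>i'\<close>.\<close>
  define T where "T = (\<Sum>k = j'..<m. 2 ^ k / 2 ^ m * V $$ (j', k))"
  define S where "S = (\<Sum>k = j'..<i'. 2 ^ k / 2 ^ i' * V $$ (j', k))"
  define R where "R = (\<Sum>k = i..<m. 2 ^ k / 2 ^ m * V $$ (j', k))"
  have T_eq: "(\<Sum>l = 1..n - j. 2 powi (- int l) * entry1 V j (n - l)) = T"
    using sum_powi_reindex[where q = m and p = j' and f = "\<lambda>k. V $$ (j', k)"] by (simp add: T_def nm j')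
  have S_eq: "(\<Sum>l = 1..i - j. 2 powi (- int l) * entry1 V j (i - l)) = S"
    using sum_powi_reindex[where q = i' and p = j' and f = "\<lambda>k. V $$ (j', k)"] by (simp add: S_def i' j')
  have R_eq: "(\<Sum>l = 1..n - i - 1. 2 powi (- int l) * entry1 V j (n - l)) = R"
    using sum_powi_reindex[where q = m and p = i and f = "\<lambda>k. V $$ (j', k)"] by (simp add: R_def nm i' j')
  have pown: "2 powi (1 - int n) = (1 / 2 ^ m :: real)"
    by (simp add: nm power_int_minus field_simps)
  have powi: "2 powi (- int i) = (1 / 2 ^ i :: real)"
    by (simp add: power_int_minus field_simps)
  have aj: "a $ j' = - T" if "j < n"
    unfolding a_def T_def using that j' nm V0
    by (intro inv_col_entry_last[OF Vinv(1)]) auto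
  have bj: "b $ j' = (if i < j then 0 else 1 / 2 * (V $$ (j', i') - S))" if "i < n" "j < n"
    unfolding b_def S_def using that i' j' nm V0
    by (subst inv_col_entry_less[OF Vinv(1)]) auto
  \<comment> \<open>Splitting the sum at position \<open>i\<close> produces the terms of both sums in the second formula.\<close>
  have T_split: "T = 2 ^ i' / 2 ^ m * S + 2 ^ i' / 2 ^ m * V $$ (j', i') + R" if "j \<le> i" "i < n"
  proof -
    have "T = (\<Sum>k = j'..<i'. 2 ^ k / 2 ^ m * V $$ (j', k)) +
        (\<Sum>k = i'..<m. 2 ^ k / 2 ^ m * V $$ (j', k))"
      unfolding T_def using that i' j' nm by (subst sum.atLeastLessThan_concat) auto
    also have "(\<Sum>k = j'..<i'. 2 ^ k / 2 ^ m * V $$ (j', k)) = 2 ^ i' / 2 ^ m * S"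
      by (simp add: S_def sum_distrib_left)
    also have "(\<Sum>k = i'..<m. 2 ^ k / 2 ^ m * V $$ (j', k)) = 2 ^ i' / 2 ^ m * V $$ (j', i') + R"
      unfolding R_def using that i' nm by (simp add: sum.atLeast_Suc_lessThan)
    finally show ?thesis by simp
  qed
  show ?thesis
    unfolding T_eq S_eq R_eq pown powi
  proof (intro conjI impI; elim conjE)
    assume c: "i < j" "j < n"
    then show "p = 1 / (1 / 2 ^ m + \<epsilon> * (1 / 2 ^ i) * T)"
      unfolding p_eq using aj bj bn by simp
  next
    assume c: "j \<le> i" "i < n"
    define x where "x = 1 + 1 / 2 * \<epsilon> * (V $$ (j', i') - S)"
    have x: "1 + \<epsilon> * b $ j' = x" using c bj by (simp add: x_def)
    have "x / 2 ^ m + \<epsilon> * T / 2 ^ i = 1 / 2 ^ m + \<epsilon> * (1 / 2 ^ m * V $$ (j', i') + 1 / 2 ^ i * R)"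
      unfolding T_split[OF c] x_def i'(1) by (simp add: field_simps)
    moreover have "p = x / (x / 2 ^ m + \<epsilon> * T / 2 ^ i)"
      unfolding p_eq x using c aj bn by simp
    ultimately show "p = (1 + 1 / 2 * \<epsilon> * (entry1 V j i - S)) /
        (1 / 2 ^ m + \<epsilon> * (1 / 2 ^ m * entry1 V j i + 1 / 2 ^ i * R))"
      by (simp add: x_def i' j')
  next
    assume c: "i < n" "j = n"
    then have "a $ j' = 1 / 2 ^ m" "b $ j' = 1 / 2 ^ i" using an bn j' nm by auto
    then show "p = 2 ^ (n - 1) * (1 + \<epsilon> * (1 / 2 ^ i))"
      unfolding p_eq using bn c nm by (simp add: diff_divide_distrib[symmetric] add_divide_distrib)
  next
    assume c: "i = n" "j < n"
    then have "b = a" using i' nm by (simp add: a_def b_def)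
    then show "p = 2 ^ (n - 1) * (1 - \<epsilon> * T)"
      unfolding p_eq using c aj an nm by (simp add: diff_divide_distrib)
  next
    assume c: "i = n" "j = n"
    then have "b = a" "j' = m" using i' j' nm by (auto simp: a_def b_def)
    then show "p = 2 ^ (n - 1) + \<epsilon>"
      unfolding p_eq using an nm by (simp add: add_divide_distrib algebra_simps)
  qed
qed

end
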